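(* Let $m\ge 2$, $n\ge 1$, $N=\{1,\dots,n\}$, and let $\mathcal{A}=(a_{i_1\cdots i_m})\in\mathbb{C}^{[m,n]}$ be a complex tensor of order $m$ and dimension $n$. For $i\in N$ and $j\in N$, $j\neq i$, put $$\Gamma_i(\mathcal{A})=\{z\in\mathbb{C}: |z-a_{i\cdots i}|\le r_i(\mathcal{A})\},\qquad \Delta_{ij}(\mathcal{A})=\{z\in\mathbb{C}: |z-a_{j\cdots j}|<2|a_{ji\cdots i}|-r_j(\mathcal{A})\},$$ $$\Delta_i(\mathcal{A})=\bigcup_{j\in N,\, j\ne i}\Delta_{ij}(\mathcal{A}),\qquad \Omega_i(\mathcal{A})=\Gamma_i(\mathcal{A})\setminus\Delta_i(\mathcal{A}).$$ Then $$\sigma(\mathcal{A})\subseteq\Omega(\mathcal{A}):=\bigcup_{i\in N}\Omega_i(\mathcal{A}).$$ Furthermore, $\Omega(\mathcal{A})\subseteq\Gamma(\mathcal{A}):=\bigcup_{i\in N}\Gamma_i(\mathcal{A})$.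
   Context: A tensor $\mathcal{A}=(a_{i_1\cdots i_m})\in\mathbb{C}^{[m,n]}$ of order $m$ and dimension $n$ is a family of complex numbers $a_{i_1\cdots i_m}$ indexed by $(i_1,\dots,i_m)\in N^m$, $N=\{1,\dots,n\}$. The entry $a_{j i\cdots i}$ is the one with first index $j$ and the remaining $m-1$ indices equal to $i$; $a_{i\cdots i}$ has all $m$ indices equal to $i$. For $x\in\mathbb{C}^n$, $\mathcal{A}x^{m-1}\in\mathbb{C}^n$ is given by $(\mathcal{A}x^{m-1})_i=\sum_{i_2,\dots,i_m\in N}a_{ii_2\cdots i_m}x_{i_2}\cdots x_{i_m}$, and $x^{[m-1]}=(x_1^{m-1},\dots,x_n^{m-1})^T$. A number $\lambda\in\mathbb{C}$ is an eigenvalue of $\mathcal{A}$ if there is a nonzero $x\in\mathbb{C}^n$ with $\mathcal{A}x^{m-1}=\lambda x^{[m-1]}$; $\sigma(\mathcal{A})$ is the set of all eigenvalues of $\mathcal{A}$. For $i\in N$, $r_i(\mathcal{A})=\sum |a_{ii_2\cdots i_m}|$, the sum being over all $(i_2,\dots,i_m)\in N^{m-1}$ with $(i_2,\dots,i_m)\neq(i,\dots,i)$. *)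

theory Defs
  imports "HOL-Analysis.Analysis"
begin

text \<open>
  The index set \<open>N\<close> is a finite type \<open>'n\<close>, so the dimension is \<open>n = CARD('n) \<ge> 1\<close>.
  A tensor of order \<open>m\<close> is given by its entries \<open>A [i\<^sub>1, \<dots>, i\<^sub>m]\<close>. The order is an explicit
  parameter of the notions below: for \<open>m \<ge> 1\<close> they read \<open>A\<close> only at lists of length \<open>m\<close>.
\<close>

type_synonym 'n tensor = "'n list \<Rightarrow> complex"

definition multi_indices :: "nat \<Rightarrow> 'n::finite list set" where
  "multi_indices k = {js. length js = k}"

lemma finite_multi_indices [simp]: "finite (multi_indices k :: 'n::finite list set)"
  using finite_lists_length_eq[of "UNIV :: 'n set" k] by (simp add: multi_indices_def)

definition tensor_apply :: "nat \<Rightarrow> 'n::finite tensor \<Rightarrow> complex ^ 'n \<Rightarrow> complex ^ 'n" where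
  "tensor_apply m A x =
     (\<chi> i. \<Sum>js\<in>multi_indices (m - 1). A (i # js) * (\<Prod>j\<leftarrow>js. x $ j))"

definition vec_power :: "complex ^ 'n \<Rightarrow> nat \<Rightarrow> complex ^ 'n::finite" where
  "vec_power x k = (\<chi> i. (x $ i) ^ k)"

definition tensor_eigenvalue :: "nat \<Rightarrow> 'n::finite tensor \<Rightarrow> complex \<Rightarrow> bool" where
  "tensor_eigenvalue m A z \<longleftrightarrow>
     (\<exists>x. x \<noteq> 0 \<and> tensor_apply m A x = z *s vec_power x (m - 1))"

definition tensor_spectrum :: "nat \<Rightarrow> 'n::finite tensor \<Rightarrow> complex set" where
  "tensor_spectrum m A = {z. tensor_eigenvalue m A z}"

definition diag_entry :: "nat \<Rightarrow> 'n tensor \<Rightarrow> 'n \<Rightarrow> complex" where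
  "diag_entry m A i = A (replicate m i)"

definition row_radius :: "nat \<Rightarrow> 'n::finite tensor \<Rightarrow> 'n \<Rightarrow> real" where
  "row_radius m A i =
     (\<Sum>js\<in>multi_indices (m - 1) - {replicate (m - 1) i}. cmod (A (i # js)))"

definition Gamma_disc :: "nat \<Rightarrow> 'n::finite tensor \<Rightarrow> 'n \<Rightarrow> complex set" where
  "Gamma_disc m A i = {z. cmod (z - diag_entry m A i) \<le> row_radius m A i}"

definition Delta_disc :: "nat \<Rightarrow> 'n::finite tensor \<Rightarrow> 'n \<Rightarrow> 'n \<Rightarrow> complex set" where
  "Delta_disc m A i j =
     {z. cmod (z - diag_entry m A j)
           < 2 * cmod (A (j # replicate (m - 1) i)) - row_radius m A j}"

definition Delta_set :: "nat \<Rightarrow> 'n::finite tensor \<Rightarrow> 'n \<Rightarrow> complex set" where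
  "Delta_set m A i = (\<Union>j\<in>{j. j \<noteq> i}. Delta_disc m A i j)"

definition Omega_piece :: "nat \<Rightarrow> 'n::finite tensor \<Rightarrow> 'n \<Rightarrow> complex set" where
  "Omega_piece m A i = Gamma_disc m A i - Delta_set m A i"

definition Gamma_set :: "nat \<Rightarrow> 'n::finite tensor \<Rightarrow> complex set" where
  "Gamma_set m A = (\<Union>i. Gamma_disc m A i)"

definition Omega_set :: "nat \<Rightarrow> 'n::finite tensor \<Rightarrow> complex set" where
  "Omega_set m A = (\<Union>i. Omega_piece m A i)"

end

theory Submission
  imports Defs
begin

text \<open>
  Let \<open>x\<close> be an eigenvector for \<open>z\<close> and let \<open>p\<close> be an index at which \<open>\<bar>x\<^sub>p\<bar>\<close> is maximal. Write
  \<open>k = m - 1\<close>. Every monomial of degree \<open>k\<close> in the entries of \<open>x\<close> is bounded by \<open>\<bar>x\<^sub>p\<bar>\<^sup>k\<close>, which is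
  positive. The eigenvalue equation in row \<open>j\<close> says that \<open>(z - a\<^bsub>j\<dots>j\<^esub>) x\<^sub>j\<^sup>k\<close> is the off-diagonal
  sum of that row. The single index \<open>p\<close> places \<open>z\<close> in \<open>\<Omega>\<^sub>p\<close>, for two reasons.

  In row \<open>p\<close>, dividing by \<open>\<bar>x\<^sub>p\<bar>\<^sup>k\<close> is the classical Gershgorin argument
  (\<open>eigenvalue_in_Gamma_disc\<close>). In a row \<open>j \<noteq> p\<close>, the entry \<open>a\<^bsub>jp\<dots>p\<^esub>\<close> multiplies the
  largest monomial \<open>x\<^sub>p\<^sup>k\<close> itself. If that entry dominates the row, only a large value of
  \<open>\<bar>z - a\<^bsub>j\<dots>j\<^esub>\<bar>\<close> can balance it; this excludes the disc \<open>\<Delta>\<^bsub>pj\<^esub>\<close>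
  (\<open>eigenvalue_notin_Delta_disc\<close>).
\<close>

lemma norm_monomial_le:
  fixes x :: "complex ^ 'n::finite"
  assumes "\<And>i. cmod (x $ i) \<le> M"
  shows "cmod (\<Prod>j\<leftarrow>js. x $ j) \<le> M ^ length js"
proof (induction js)
  case (Cons j js)
  have "0 \<le> M"
    using assms[of j] norm_ge_zero order_trans by blast
  with Cons assms[of j] show ?case
    by (auto simp: norm_mult intro!: mult_mono)
qed simp

lemma norm_weighted_monomials_le:
  fixes x :: "complex ^ 'n::finite"
  assumes "\<And>i. cmod (x $ i) \<le> M" and "S \<subseteq> multi_indices k"
  shows "cmod (\<Sum>js\<in>S. c js * (\<Prod>j\<leftarrow>js. x $ j)) \<le> (\<Sum>js\<in>S. cmod (c js)) * M ^ k"
proof -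
  have "cmod (\<Sum>js\<in>S. c js * (\<Prod>j\<leftarrow>js. x $ j)) \<le> (\<Sum>js\<in>S. cmod (c js) * M ^ k)"
  proof (rule sum_norm_le)
    fix js assume "js \<in> S"
    with assms(2) have "length js = k"
      by (auto simp: multi_indices_def)
    with norm_monomial_le[of x M js, OF assms(1)]
    show "cmod (c js * (\<Prod>j\<leftarrow>js. x $ j)) \<le> cmod (c js) * M ^ k"
      by (simp add: norm_mult mult_left_mono)
  qed
  then show ?thesis
    by (simp add: sum_distrib_right)
qed

lemma replicate_in_multi_indices [simp]: "replicate k i \<in> multi_indices k"
  by (simp add: multi_indices_def)

lemma eigenvalue_row_equation:
  assumes "m \<ge> 1" and "tensor_apply m A x = z *s vec_power x (m - 1)"
  shows "(z - diag_entry m A j) * (x $ j) ^ (m - 1) =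
    (\<Sum>js\<in>multi_indices (m - 1) - {replicate (m - 1) j}. A (j # js) * (\<Prod>i\<leftarrow>js. x $ i))"
proof -
  have "(\<Sum>js\<in>multi_indices (m - 1). A (j # js) * (\<Prod>i\<leftarrow>js. x $ i)) = z * (x $ j) ^ (m - 1)"
    using arg_cong[OF assms(2), of "\<lambda>v. v $ j"]
    by (simp add: tensor_apply_def vec_power_def)
  moreover have "diag_entry m A j = A (j # replicate (m - 1) j)"
    using assms(1) by (cases m) (auto simp: diag_entry_def)
  ultimately show ?thesis
    by (simp add: sum_diff1 algebra_simps prod_list_replicate)
qed

lemma eigenvalue_in_Gamma_disc:
  assumes "m \<ge> 1" and eig: "tensor_apply m A x = z *s vec_power x (m - 1)"
    and max: "\<And>i. cmod (x $ i) \<le> cmod (x $ p)" and nz: "x $ p \<noteq> 0"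
  shows "z \<in> Gamma_disc m A p"
proof -
  let ?M = "cmod (x $ p) ^ (m - 1)"
  have "cmod (z - diag_entry m A p) * ?M = cmod ((z - diag_entry m A p) * (x $ p) ^ (m - 1))"
    by (simp add: norm_mult norm_power)
  also have "\<dots> \<le> row_radius m A p * ?M"
    unfolding eigenvalue_row_equation[OF assms(1) eig] row_radius_def
    by (rule norm_weighted_monomials_le[OF max]) auto
  finally show ?thesis
    using nz by (simp add: Gamma_disc_def)
qed

text \<open>
  The term with coefficient \<open>a\<^bsub>jp\<dots>p\<^esub>\<close> is isolated in row \<open>j\<close>, and the remaining off-diagonal
  coefficients have total modulus \<open>r\<^sub>j - \<bar>a\<^bsub>jp\<dots>p\<^esub>\<bar>\<close>. Hence
  \<open>\<bar>a\<^bsub>jp\<dots>p\<^esub>\<bar> \<le> \<bar>z - a\<^bsub>j\<dots>j\<^esub>\<bar> + r\<^sub>j - \<bar>a\<^bsub>jp\<dots>p\<^esub>\<bar>\<close>, which explains the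
  factor \<open>2\<close> in the definition of the excluded disc. For \<open>m = 1\<close> there would be no off-diagonal
  term to isolate.
\<close>

lemma eigenvalue_notin_Delta_disc:
  assumes "m \<ge> 2" and eig: "tensor_apply m A x = z *s vec_power x (m - 1)"
    and max: "\<And>i. cmod (x $ i) \<le> cmod (x $ p)" and nz: "x $ p \<noteq> 0" and "j \<noteq> p"
  shows "z \<notin> Delta_disc m A p j"
proof -
  let ?k = "m - 1"
  let ?M = "cmod (x $ p) ^ ?k"
  let ?a = "A (j # replicate ?k p)"
  let ?d = "z - diag_entry m A j"
  let ?S = "multi_indices ?k - {replicate ?k j}"
  let ?T = "?S - {replicate ?k p}"
  let ?R = "\<Sum>js\<in>?T. A (j # js) * (\<Prod>i\<leftarrow>js. x $ i)"
  have mem: "replicate ?k p \<in> ?S"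
    using assms(1) \<open>j \<noteq> p\<close> by (simp add: replicate_eq_replicate)
  have radius: "(\<Sum>js\<in>?T. cmod (A (j # js))) = row_radius m A j - cmod ?a"
    using sum.remove[OF _ mem, of "\<lambda>js. cmod (A (j # js))"] by (simp add: row_radius_def)
  have "?d * (x $ j) ^ ?k = ?a * (x $ p) ^ ?k + ?R"
    using eigenvalue_row_equation[OF _ eig, of j] assms(1)
      sum.remove[OF _ mem, of "\<lambda>js. A (j # js) * (\<Prod>i\<leftarrow>js. x $ i)"]
    by (simp add: prod_list_replicate)
  then have "?a * (x $ p) ^ ?k = ?d * (x $ j) ^ ?k - ?R"
    by simp
  then have "cmod ?a * ?M = cmod (?d * (x $ j) ^ ?k - ?R)"
    by (metis norm_mult norm_power)
  also have "\<dots> \<le> cmod (?d * (x $ j) ^ ?k) + cmod ?R"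
    by (rule norm_triangle_ineq4)
  also have "\<dots> \<le> cmod ?d * ?M + (row_radius m A j - cmod ?a) * ?M"
  proof (rule add_mono)
    show "cmod (?d * (x $ j) ^ ?k) \<le> cmod ?d * ?M"
      by (simp add: norm_mult norm_power mult_left_mono power_mono max)
    show "cmod ?R \<le> (row_radius m A j - cmod ?a) * ?M"
      unfolding radius[symmetric] by (rule norm_weighted_monomials_le[OF max]) auto
  qed
  finally have "cmod ?a * ?M \<le> (cmod ?d + (row_radius m A j - cmod ?a)) * ?M"
    by (simp add: distrib_right)
  then have "cmod ?a \<le> cmod ?d + (row_radius m A j - cmod ?a)"
    using nz by (subst (asm) mult_le_cancel_right_pos) auto
  then show ?thesis
    by (simp add: Delta_disc_def)
qed

theorem theorem2:
  fixes m :: nat and A :: "'n::finite tensor"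
  assumes "m \<ge> 2"
  shows "tensor_spectrum m A \<subseteq> Omega_set m A \<and> Omega_set m A \<subseteq> Gamma_set m A"
proof
  show "tensor_spectrum m A \<subseteq> Omega_set m A"
  proof
    fix z assume "z \<in> tensor_spectrum m A"
    then obtain x where "x \<noteq> 0" and eig: "tensor_apply m A x = z *s vec_power x (m - 1)"
      by (auto simp: tensor_spectrum_def tensor_eigenvalue_def)
    obtain p where p: "\<And>i. cmod (x $ i) \<le> cmod (x $ p)"
      using finite_imageI[OF finite, of "\<lambda>i. cmod (x $ i)" UNIV]
        Max_in[of "range (\<lambda>i. cmod (x $ i))"] Max_ge[of "range (\<lambda>i. cmod (x $ i))"]
      by (metis (no_types, lifting) UNIV_not_empty image_is_empty imageE rangeI)
    have nz: "x $ p \<noteq> 0"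
      using p \<open>x \<noteq> 0\<close> by (auto simp: vec_eq_iff)
    have "z \<in> Gamma_disc m A p"
      using eigenvalue_in_Gamma_disc[OF _ eig p nz] assms by simp
    moreover have "z \<notin> Delta_set m A p"
      using eigenvalue_notin_Delta_disc[OF assms eig p nz] by (auto simp: Delta_set_def)
    ultimately show "z \<in> Omega_set m A"
      by (auto simp: Omega_set_def Omega_piece_def)
  qed
  show "Omega_set m A \<subseteq> Gamma_set m A"
    by (auto simp: Omega_set_def Omega_piece_def Gamma_set_def)
qed

end
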